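(* Let $C, B, B_0,\dots,B_k$ be linear endomorphisms of $V$, each self-adjoint or skew-adjoint, with $$R_{C}=\epsilon R_{B}+\sum_{i=0}^k\epsilon_iR_{B_i},\qquad \epsilon,\epsilon_i\in\{\pm1\},$$ and $\ker(B)\ne0$. Let $A:V\to\ker(B)$ be a linear operator (regarded as an endomorphism of $V$ with image in $\ker B$) such that $A*C=\pm C$. Then $$R_{C}=\sum_{i=0}^k\epsilon_iR_{A^*B_iA}.$$ Moreover, for each $i$, $R_{A^*B_iA}\in\mathcal{A}(V)$ and $R_{A^*B_iA}$ is the same build as $R_{B_i}$.
   Context: $V$ is a finite-dimensional real vector space, $\phi$ a positive definite inner product on $V$, and $A^*$ the adjoint of $A$ with respect to $\phi$. $\mathcal{A}(V)$ is the real vector space of algebraic curvature tensors: multilinear maps $R:V^4\to\mathbb{R}$ with $R(x,y,z,w)=-R(y,x,z,w)=R(z,w,x,y)$ and $R(x,y,z,w)+R(z,x,y,w)+R(y,z,x,w)=0$. For an endomorphism $A$ of $V$, $$R^S_{A}(x,y,z,w)= \phi (Ax,w) \phi (Ay,z) - \phi (Ax,z) \phi (Ay,w),$$ $$R^{\Lambda}_{A} (x,y,z,w) =\phi (Ax,w) \phi (Ay,z) - \phi (Ax,z) \phi (Ay,w) -2 \phi (Ax,y) \phi (Az,w).$$ The symbol $R_{B}$ without superscript means $R^S_B$ (symmetric build) if $B=B^*$ and $R^{\Lambda}_B$ (anti-symmetric build) if $B=-B^*$; the builds of the different terms may differ. "$R_{A^*B_iA}$ is the same build as $R_{B_i}$"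 means that $A^*B_iA$ is self-adjoint (and the tensor is $R^S$) if $B_i$ is self-adjoint, and skew-adjoint (and the tensor is $R^\Lambda$) if $B_i$ is skew-adjoint. The condition $A*C=\pm C$ means that precomposition with $A$ preserves, up to sign, the bilinear form determined by $C$: either $\phi(CAx,Ay)=\phi(Cx,y)$ for all $x,y\in V$, or $\phi(CAx,Ay)=-\phi(Cx,y)$ for all $x,y\in V$. *)

theory Defs
  imports "HOL-Analysis.Analysis"
begin

text \<open>The space \<open>V\<close> with its positive definite inner product \<open>\<phi>\<close> is a type of class
  \<open>euclidean_space\<close> with \<open>\<phi> = (\<bullet>)\<close>; \<open>A\<^sup>*\<close> is \<^const>\<open>adjoint\<close>.\<close>

type_synonym 'a tensor4 = "'a \<Rightarrow> 'a \<Rightarrow> 'a \<Rightarrow> 'a \<Rightarrow> real"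

definition algebraic_curvature_tensors :: "'a::real_vector tensor4 set" where
  "algebraic_curvature_tensors =
    {R. (\<forall>y z w. linear (\<lambda>x. R x y z w)) \<and> (\<forall>x z w. linear (\<lambda>y. R x y z w)) \<and>
        (\<forall>x y w. linear (\<lambda>z. R x y z w)) \<and> (\<forall>x y z. linear (\<lambda>w. R x y z w)) \<and>
        (\<forall>x y z w. R x y z w = - R y x z w) \<and>
        (\<forall>x y z w. R x y z w = R z w x y) \<and>
        (\<forall>x y z w. R x y z w + R z x y w + R y z x w = 0)}"

definition self_adjoint :: "('a::real_inner \<Rightarrow> 'a) \<Rightarrow> bool" where
  "self_adjoint A \<longleftrightarrow> A = adjoint A"

definition skew_adjoint :: "('a::real_inner \<Rightarrow> 'a) \<Rightarrow> bool" where
  "skew_adjoint A \<longleftrightarrow> A = (\<lambda>x. - adjoint A x)"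

definition R_sym :: "('a::real_inner \<Rightarrow> 'a) \<Rightarrow> 'a tensor4" where
  "R_sym A x y z w = (A x \<bullet> w) * (A y \<bullet> z) - (A x \<bullet> z) * (A y \<bullet> w)"

definition R_skew :: "('a::real_inner \<Rightarrow> 'a) \<Rightarrow> 'a tensor4" where
  "R_skew A x y z w =
    (A x \<bullet> w) * (A y \<bullet> z) - (A x \<bullet> z) * (A y \<bullet> w) - 2 * (A x \<bullet> y) * (A z \<bullet> w)"

text \<open>The tensor \<open>R\<^sub>B\<close> without superscript. It has no meaning when \<open>B\<close> is neither self-adjoint
  nor skew-adjoint, hence \<^const>\<open>undefined\<close>. The only linear map that is both is \<open>0\<close>, for which
  both builds vanish, so the order of the cases does not matter.\<close>

definition R_build :: "('a::real_inner \<Rightarrow> 'a) \<Rightarrow> 'a tensor4" where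
  "R_build B =
    (if self_adjoint B then R_sym B else if skew_adjoint B then R_skew B else undefined)"

definition same_build :: "('a::real_inner \<Rightarrow> 'a) \<Rightarrow> ('a \<Rightarrow> 'a) \<Rightarrow> bool" where
  "same_build B' B \<longleftrightarrow>
    (self_adjoint B \<longrightarrow> self_adjoint B' \<and> R_build B' = R_sym B') \<and>
    (skew_adjoint B \<longrightarrow> skew_adjoint B' \<and> R_build B' = R_skew B')"

text \<open>\<open>A * C = \<plusminus>C\<close>, with one sign for all arguments.\<close>

definition preserves_up_to_sign :: "('a::real_inner \<Rightarrow> 'a) \<Rightarrow> ('a \<Rightarrow> 'a) \<Rightarrow> bool" where
  "preserves_up_to_sign A C \<longleftrightarrow>
    (\<forall>x y. C (A x) \<bullet> A y = C x \<bullet> y) \<or> (\<forall>x y. C (A x) \<bullet> A y = - (C x \<bullet> y))"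

end

theory Submission
  imports Defs
begin

text \<open>Both builds of \<open>R\<^sub>B\<close> are the same quadratic expression, with its own fixed coefficients, in
  the values of the bilinear form \<open>(x, y) \<mapsto> \<phi> (B x, y)\<close>. The form of \<open>A\<^sup>* B A\<close> is the pullback
  of that of \<open>B\<close> along \<open>A\<close>, and pulling back keeps symmetry and antisymmetry. Hence
  \<open>R\<close> of \<open>A\<^sup>* B A\<close> has the same build as \<open>R\<^sub>B\<close> and is its pullback along \<open>A\<close>
  (\<open>R_build_conjugate\<close>).

  The theorem follows by pulling back the given identity. On the left, the form of \<open>C\<close> is
  preserved up to a sign and \<open>R\<^sub>C\<close> is quadratic in it, so \<open>R\<^sub>C\<close> is its own pullback
  (\<open>R_build_pullback_preserving\<close>). On the right, the term of \<open>B\<close> disappears because \<open>A\<close> maps into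
  the kernel of \<open>B\<close>, and the remaining terms become the tensors of \<open>A\<^sup>* B\<^sub>i A\<close>.\<close>

lemma self_adjoint_iff:
  fixes B :: "'a::euclidean_space \<Rightarrow> 'a"
  assumes "linear B"
  shows "self_adjoint B \<longleftrightarrow> (\<forall>x y. B x \<bullet> y = B y \<bullet> x)"
proof
  assume "self_adjoint B"
  then show "\<forall>x y. B x \<bullet> y = B y \<bullet> x"
    unfolding self_adjoint_def by (metis adjoint_works assms inner_commute)
next
  assume "\<forall>x y. B x \<bullet> y = B y \<bullet> x"
  then have "adjoint B = B"
    by (intro adjoint_unique) (simp add: inner_commute)
  then show "self_adjoint B"
    by (simp add: self_adjoint_def)
qed

lemma skew_adjoint_iff:
  fixes B :: "'a::euclidean_space \<Rightarrow> 'a"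
  assumes "linear B"
  shows "skew_adjoint B \<longleftrightarrow> (\<forall>x y. B x \<bullet> y = - (B y \<bullet> x))"
proof
  assume "skew_adjoint B"
  then have "B x = - adjoint B x" for x
    unfolding skew_adjoint_def by (rule fun_cong)
  then show "\<forall>x y. B x \<bullet> y = - (B y \<bullet> x)"
    using adjoint_works[OF assms] by (metis inner_commute inner_minus_left)
next
  assume "\<forall>x y. B x \<bullet> y = - (B y \<bullet> x)"
  then have "adjoint B = (\<lambda>x. - B x)"
    by (intro adjoint_unique) (metis inner_commute inner_minus_right)
  then show "skew_adjoint B"
    by (simp add: skew_adjoint_def)
qed

lemma R_build_self_adjoint: "self_adjoint B \<Longrightarrow> R_build B = R_sym B"
  by (simp add: R_build_def)

text \<open>When \<open>B\<close> is also self-adjoint, \<open>R_build\<close> selects the symmetric build; this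
  happens only for \<open>B = 0\<close>, where both builds vanish.\<close>

lemma R_build_skew_adjoint:
  assumes "skew_adjoint B"
  shows "R_build B = R_skew B"
proof (cases "self_adjoint B")
  case True
  have "B x = 0" for x
  proof -
    have "B x = adjoint B x"
      using True unfolding self_adjoint_def by (rule fun_cong)
    moreover have "B x = - adjoint B x"
      using assms unfolding skew_adjoint_def by (rule fun_cong)
    ultimately have "2 *\<^sub>R B x = 0"
      by (metis scaleR_2 add.right_inverse)
    then show ?thesis
      by simp
  qed
  then show ?thesis
    using True by (simp add: R_build_self_adjoint fun_eq_iff R_sym_def R_skew_def)
qed (use assms in \<open>simp add: R_build_def\<close>)

lemma R_sym_algebraic_curvature_tensor:
  fixes B :: "'a::euclidean_space \<Rightarrow> 'a"
  assumes "linear B" "self_adjoint B"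
  shows "R_sym B \<in> algebraic_curvature_tensors"
proof -
  interpret linear B by fact
  have sym: "B x \<bullet> y = B y \<bullet> x" for x y
    using assms self_adjoint_iff by blast
  have "R_sym B x y z w = R_sym B z w x y" for x y z w
    using sym[of x z] sym[of y w] sym[of x w] sym[of y z] by (simp add: R_sym_def)
  moreover have "R_sym B x y z w = - R_sym B y x z w" for x y z w
    by (simp add: R_sym_def)
  moreover have "R_sym B x y z w + R_sym B z x y w + R_sym B y z x w = 0" for x y z w
    using sym[of x y] sym[of y z] sym[of z x] by (simp add: R_sym_def)
  moreover have "linear (\<lambda>x. R_sym B x y z w)" "linear (\<lambda>y. R_sym B x y z w)"
    "linear (\<lambda>z. R_sym B x y z w)" "linear (\<lambda>w. R_sym B x y z w)" for x y z w
    by (auto intro!: linearI simp: R_sym_def add scale inner_simps algebra_simps)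
  ultimately show ?thesis
    unfolding algebraic_curvature_tensors_def by blast
qed

text \<open>The last term of \<open>R_skew\<close> is what makes the cyclic identity hold: for an antisymmetric form
  the cyclic sum of the first two terms is twice the cyclic sum of
  \<open>\<phi> (B x, y) \<phi> (B z, w)\<close>.\<close>

lemma R_skew_algebraic_curvature_tensor:
  fixes B :: "'a::euclidean_space \<Rightarrow> 'a"
  assumes "linear B" "skew_adjoint B"
  shows "R_skew B \<in> algebraic_curvature_tensors"
proof -
  interpret linear B by fact
  have skew: "B x \<bullet> y = - (B y \<bullet> x)" for x y
    using assms skew_adjoint_iff by blast
  have "R_skew B x y z w = - R_skew B y x z w" for x y z w
    using skew[of x y] by (simp add: R_skew_def)
  moreover have "R_skew B x y z w = R_skew B z w x y" for x y z w
    using skew[of x z] skew[of y w] skew[of x w] skew[of y z] by (simp add: R_skew_def)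
  moreover have "R_skew B x y z w + R_skew B z x y w + R_skew B y z x w = 0" for x y z w
    using skew[of x y] skew[of y z] skew[of z x] by (simp add: R_skew_def)
  moreover have "linear (\<lambda>x. R_skew B x y z w)" "linear (\<lambda>y. R_skew B x y z w)"
    "linear (\<lambda>z. R_skew B x y z w)" "linear (\<lambda>w. R_skew B x y z w)" for x y z w
    by (auto intro!: linearI simp: R_skew_def add scale inner_simps algebra_simps)
  ultimately show ?thesis
    unfolding algebraic_curvature_tensors_def by blast
qed

lemma R_build_algebraic_curvature_tensor:
  fixes B :: "'a::euclidean_space \<Rightarrow> 'a"
  assumes "linear B" "self_adjoint B \<or> skew_adjoint B"
  shows "R_build B \<in> algebraic_curvature_tensors"
  using assms R_sym_algebraic_curvature_tensor R_skew_algebraic_curvature_tensor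
  by (auto simp only: R_build_self_adjoint R_build_skew_adjoint)

lemma R_build_cases:
  assumes "self_adjoint B \<or> skew_adjoint B"
  obtains "R_build B = R_sym B" | "R_build B = R_skew B"
  using assms R_build_self_adjoint R_build_skew_adjoint by blast

lemma R_build_pullback_kernel:
  assumes "self_adjoint B \<or> skew_adjoint B" and "range A \<subseteq> {v. B v = 0}"
  shows "R_build B (A x) (A y) (A z) (A w) = 0"
proof -
  have "B (A v) = 0" for v
    using assms(2) by auto
  with assms(1) show ?thesis
    by (auto elim!: R_build_cases simp: R_sym_def R_skew_def)
qed

text \<open>The sign of the preserved form occurs squared in every term of \<open>R\<^sub>C\<close>.\<close>

lemma R_build_pullback_preserving:
  assumes "self_adjoint C \<or> skew_adjoint C" and "preserves_up_to_sign A C"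
  shows "R_build C (A x) (A y) (A z) (A w) = R_build C x y z w"
proof -
  consider "\<And>x y. C (A x) \<bullet> A y = C x \<bullet> y" | "\<And>x y. C (A x) \<bullet> A y = - (C x \<bullet> y)"
    using assms(2) unfolding preserves_up_to_sign_def by blast
  then show ?thesis
    using assms(1)
    by cases (auto elim!: R_build_cases simp: R_sym_def R_skew_def)
qed

lemma linear_conjugate:
  fixes A B :: "'a::euclidean_space \<Rightarrow> 'a"
  assumes "linear A" "linear B"
  shows "linear (adjoint A \<circ> B \<circ> A)"
  by (intro linear_compose adjoint_linear assms)

lemma inner_conjugate:
  fixes A B :: "'a::euclidean_space \<Rightarrow> 'a"
  assumes "linear A"
  shows "(adjoint A \<circ> B \<circ> A) x \<bullet> y = B (A x) \<bullet> A y"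
  by (simp add: adjoint_clauses(2) assms)

lemma self_adjoint_conjugate:
  fixes A B :: "'a::euclidean_space \<Rightarrow> 'a"
  assumes "linear A" "linear B" "self_adjoint B"
  shows "self_adjoint (adjoint A \<circ> B \<circ> A)"
  unfolding self_adjoint_iff[OF linear_conjugate[OF assms(1,2)]] inner_conjugate[OF assms(1)]
  using assms(2,3) self_adjoint_iff by blast

lemma skew_adjoint_conjugate:
  fixes A B :: "'a::euclidean_space \<Rightarrow> 'a"
  assumes "linear A" "linear B" "skew_adjoint B"
  shows "skew_adjoint (adjoint A \<circ> B \<circ> A)"
  unfolding skew_adjoint_iff[OF linear_conjugate[OF assms(1,2)]] inner_conjugate[OF assms(1)]
  using assms(2,3) skew_adjoint_iff by blast

lemma same_build_conjugate:
  fixes A B :: "'a::euclidean_space \<Rightarrow> 'a"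
  assumes "linear A" "linear B"
  shows "same_build (adjoint A \<circ> B \<circ> A) B"
  unfolding same_build_def
  using assms self_adjoint_conjugate skew_adjoint_conjugate R_build_self_adjoint
    R_build_skew_adjoint by blast

lemma R_build_conjugate:
  fixes A B :: "'a::euclidean_space \<Rightarrow> 'a"
  assumes "linear A" "linear B" "self_adjoint B \<or> skew_adjoint B"
  shows "R_build (adjoint A \<circ> B \<circ> A) x y z w = R_build B (A x) (A y) (A z) (A w)"
  using assms(3)
proof
  assume "self_adjoint B"
  with self_adjoint_conjugate[OF assms(1,2)] show ?thesis
    by (simp only: R_build_self_adjoint R_sym_def inner_conjugate[OF assms(1)])
next
  assume "skew_adjoint B"
  with skew_adjoint_conjugate[OF assms(1,2)] show ?thesis
    by (simp only: R_build_skew_adjoint R_skew_def inner_conjugate[OF assms(1)])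
qed

theorem theorem6p2:
  fixes A B C :: "'a::euclidean_space \<Rightarrow> 'a"
    and Bs :: "nat \<Rightarrow> 'a \<Rightarrow> 'a"
    and k :: nat
    and \<epsilon> :: real
    and \<epsilon>s :: "nat \<Rightarrow> real"
  assumes "linear C" and "self_adjoint C \<or> skew_adjoint C"
    and "linear B" and "self_adjoint B \<or> skew_adjoint B"
    and "\<And>i. i \<le> k \<Longrightarrow> linear (Bs i)"
    and "\<And>i. i \<le> k \<Longrightarrow> self_adjoint (Bs i) \<or> skew_adjoint (Bs i)"
    and "\<epsilon> \<in> {1, -1}" and "\<And>i. i \<le> k \<Longrightarrow> \<epsilon>s i \<in> {1, -1}"
    and "R_build C =
      (\<lambda>x y z w. \<epsilon> * R_build B x y z w + (\<Sum>i = 0..k. \<epsilon>s i * R_build (Bs i) x y z w))"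
    and "{v. B v = 0} \<noteq> {0}"
    and "linear A" and "range A \<subseteq> {v. B v = 0}"
    and "preserves_up_to_sign A C"
  shows "R_build C =
      (\<lambda>x y z w. \<Sum>i = 0..k. \<epsilon>s i * R_build (adjoint A \<circ> Bs i \<circ> A) x y z w) \<and>
    (\<forall>i\<le>k. R_build (adjoint A \<circ> Bs i \<circ> A) \<in> algebraic_curvature_tensors \<and>
      same_build (adjoint A \<circ> Bs i \<circ> A) (Bs i))"
proof (intro conjI allI impI ext)
  fix x y z w
  have "R_build C x y z w = R_build C (A x) (A y) (A z) (A w)"
    using assms(2,13) by (simp add: R_build_pullback_preserving)
  also have "\<dots> = (\<Sum>i = 0..k. \<epsilon>s i * R_build (Bs i) (A x) (A y) (A z) (A w))"
    using assms(4,12) by (simp add: assms(9) R_build_pullback_kernel)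
  also have "\<dots> = (\<Sum>i = 0..k. \<epsilon>s i * R_build (adjoint A \<circ> Bs i \<circ> A) x y z w)"
    using assms(5,6,11) by (intro sum.cong) (simp_all only: atLeastAtMost_iff R_build_conjugate)
  finally show "R_build C x y z w =
      (\<Sum>i = 0..k. \<epsilon>s i * R_build (adjoint A \<circ> Bs i \<circ> A) x y z w)" .
next
  fix i assume "i \<le> k"
  then show "R_build (adjoint A \<circ> Bs i \<circ> A) \<in> algebraic_curvature_tensors"
    by (metis R_build_algebraic_curvature_tensor assms(5,6,11) linear_conjugate
        self_adjoint_conjugate skew_adjoint_conjugate)
next
  fix i assume "i \<le> k"
  then show "same_build (adjoint A \<circ> Bs i \<circ> A) (Bs i)"
    using assms(5,11) by (simp only: same_build_conjugate)
qed

end
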